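(* Let $A_2=\{231,321,4123,21534\}$. A permutation belongs to $\operatorname{Av}(A_2)$ if and only if it is of the form $\pi\oplus\sigma\oplus\tau$, where $\pi$ is an increasing permutation (possibly empty), $\sigma$ is either empty or equal to $312$, and $\tau$ is a Fibonacci permutation (possibly empty).
   Context: For a set $S$ of permutations, $\operatorname{Av}(S)$ is the set of all permutations avoiding every pattern in $S$ (in the classical sense: no subsequence is order isomorphic to the pattern). A Fibonacci permutation is a permutation in $\operatorname{Av}(231,312,321)$. For permutations $\pi$ of length $n$ and $\sigma$ of length $k$, $\pi\oplus\sigma$ is $\pi$ followed by $\sigma$ with every entry of $\sigma$ increased by $n$. *)

theory Defs
  imports "HOL-Library.Sublist"
begin

text \<open>Permutations are written in one-line notation, as lists with entries \<open>1, \<dots>, n\<close>;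
  the empty permutation is \<open>[]\<close>.\<close>

definition is_permutation :: "nat list \<Rightarrow> bool" where
  "is_permutation p \<longleftrightarrow> distinct p \<and> set p = {1..length p}"

definition order_isomorphic :: "nat list \<Rightarrow> nat list \<Rightarrow> bool" where
  "order_isomorphic xs ys \<longleftrightarrow> length xs = length ys \<and>
     (\<forall>i < length xs. \<forall>j < length xs. xs ! i < xs ! j \<longleftrightarrow> ys ! i < ys ! j)"

text \<open>\<^const>\<open>subseq\<close> is the relation of being a not necessarily contiguous subsequence.\<close>

definition avoids :: "nat list \<Rightarrow> nat list \<Rightarrow> bool" where
  "avoids p q \<longleftrightarrow> \<not> (\<exists>s. subseq s p \<and> order_isomorphic s q)"

definition Av :: "nat list set \<Rightarrow> nat list set" where
  "Av S = {p. is_permutation p \<and> (\<forall>q \<in> S. avoids p q)}"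

definition is_fibonacci :: "nat list \<Rightarrow> bool" where
  "is_fibonacci p \<longleftrightarrow> p \<in> Av {[2,3,1], [3,1,2], [3,2,1]}"

definition is_increasing :: "nat list \<Rightarrow> bool" where
  "is_increasing p \<longleftrightarrow> is_permutation p \<and> sorted_wrt (<) p"

definition direct_sum :: "nat list \<Rightarrow> nat list \<Rightarrow> nat list" (infixr "\<oplus>" 65) where
  "p \<oplus> q = p @ map (\<lambda>x. x + length p) q"

definition A2 :: "nat list set" where
  "A2 = {[2,3,1], [3,2,1], [4,1,2,3], [2,1,5,3,4]}"

end

theory Submission
  imports Defs
begin

text \<open>A permutation avoiding \<open>231\<close> and \<open>321\<close> is a direct sum of blocks \<open>k 1 2 \<dots> (k - 1)\<close>: the entries
  smaller than the first one must follow it immediately and in increasing order. Avoiding \<open>4123\<close>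
  leaves the blocks \<open>1\<close>, \<open>21\<close> and \<open>312\<close>, and avoiding \<open>21534 = 21 \<oplus> 312\<close> says that
  only \<open>1\<close>'s may come before a block \<open>312\<close>. Fibonacci permutations are the direct sums of
  blocks \<open>1\<close> and \<open>21\<close>.\<close>

text \<open>Keeps the entry \<open>1\<close> of literal lists from being simplified to
  \<open>Suc 0\<close>.\<close>

declare One_nat_def [simp del]

section \<open>Order isomorphism and pattern avoidance\<close>

lemma order_isomorphic_lengthD: "order_isomorphic s q \<Longrightarrow> length s = length q"
  by (simp add: order_isomorphic_def)

lemma order_isomorphic_nth_less_iff:
  "order_isomorphic s q \<Longrightarrow> i < length q \<Longrightarrow> j < length q \<Longrightarrow> s ! i < s ! j \<longleftrightarrow> q ! i < q ! j"
  by (simp add: order_isomorphic_def)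

lemma order_isomorphic_shift_iff [simp]:
  "order_isomorphic (map (\<lambda>x. x + n) s) q \<longleftrightarrow> order_isomorphic s q"
  by (auto simp: order_isomorphic_def)

lemma order_isomorphic_Nil: "order_isomorphic s [] \<longleftrightarrow> s = []"
  by (auto simp: order_isomorphic_def)

text \<open>Peeling off one entry at a time turns order isomorphism with a literal pattern into
  finitely many comparisons. Both directions of \<open><\<close> are recorded because entries may be
  equal.\<close>

lemma order_isomorphic_Cons:
  "order_isomorphic s (y # ys) \<longleftrightarrow> (\<exists>x xs. s = x # xs \<and>
    list_all2 (\<lambda>a b. (x < a \<longleftrightarrow> y < b) \<and> (a < x \<longleftrightarrow> b < y)) xs ys \<and> order_isomorphic xs ys)"
proof (cases s)
  case (Cons x xs)
  then show ?thesis
    by (auto simp: order_isomorphic_def list_all2_conv_all_nth All_less_Suc2)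
qed (simp add: order_isomorphic_def)

text \<open>Here and for the patterns below, comparing entries adjacent in value suffices; the other
  comparisons follow by transitivity.\<close>

lemma order_isomorphic_231:
  "order_isomorphic s [2,3,1] \<longleftrightarrow> (\<exists>a b c. s = [a,b,c] \<and> c < a \<and> a < b)"
  by (rule iffI; clarsimp simp: order_isomorphic_Cons order_isomorphic_Nil list_all2_Cons2)

lemma order_isomorphic_321:
  "order_isomorphic s [3,2,1] \<longleftrightarrow> (\<exists>a b c. s = [a,b,c] \<and> c < b \<and> b < a)"
  by (rule iffI; clarsimp simp: order_isomorphic_Cons order_isomorphic_Nil list_all2_Cons2)

lemma order_isomorphic_312:
  "order_isomorphic s [3,1,2] \<longleftrightarrow> (\<exists>a b c. s = [a,b,c] \<and> b < c \<and> c < a)"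
  by (rule iffI; clarsimp simp: order_isomorphic_Cons order_isomorphic_Nil list_all2_Cons2)

lemma order_isomorphic_4123:
  "order_isomorphic s [4,1,2,3] \<longleftrightarrow> (\<exists>a b c d. s = [a,b,c,d] \<and> b < c \<and> c < d \<and> d < a)"
  by (rule iffI; clarsimp simp: order_isomorphic_Cons order_isomorphic_Nil list_all2_Cons2)

lemma order_isomorphic_21534:
  "order_isomorphic s [2,1,5,3,4] \<longleftrightarrow>
    (\<exists>a b c d e. s = [a,b,c,d,e] \<and> b < a \<and> a < d \<and> d < e \<and> e < c)"
  by (rule iffI; clarsimp simp: order_isomorphic_Cons order_isomorphic_Nil list_all2_Cons2)

lemmas order_isomorphic_patterns =
  order_isomorphic_231 order_isomorphic_321 order_isomorphic_312
  order_isomorphic_4123 order_isomorphic_21534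

lemma set_subseq: "subseq xs ys \<Longrightarrow> set xs \<subseteq> set ys"
  by (metis set_nths_subset subseq_conv_nths)

lemma sorted_wrt_subseq:
  assumes "subseq xs ys" "sorted_wrt P ys"
  shows "sorted_wrt P xs"
  using assms by (induction rule: list_emb.induct) (auto dest: set_subseq)

lemma avoidsD: "avoids p q \<Longrightarrow> subseq s p \<Longrightarrow> \<not> order_isomorphic s q"
  unfolding avoids_def by blast

lemma avoids_shorter: "length p < length q \<Longrightarrow> avoids p q"
  unfolding avoids_def by (auto dest!: list_emb_length order_isomorphic_lengthD)

lemma avoids_same_length:
  "length p = length q \<Longrightarrow> avoids p q \<longleftrightarrow> \<not> order_isomorphic p q"
  unfolding avoids_def using subseq_same_length order_isomorphic_lengthD by fastforce

text \<open>The first three entries of an occurrence of \<open>4123\<close> form a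
  \<open>312\<close>.\<close>

lemma avoids_4123_if_312: "avoids p [3,1,2] \<Longrightarrow> avoids p [4,1,2,3]"
  unfolding avoids_def order_isomorphic_patterns
proof (clarify)
  fix a b c d
  assume no_312: "\<nexists>s. subseq s p \<and> (\<exists>a b c. s = [a,b,c] \<and> b < c \<and> c < a)"
    and s: "subseq [a,b,c,d] p" and "b < c" "c < d" "d < a"
  have "subseq [a,b,c] p" using subseq_order.trans[OF _ s, of "[a,b,c]"] by simp
  moreover have "c < a" using \<open>c < d\<close> \<open>d < a\<close> by (rule less_trans)
  ultimately show False using no_312 \<open>b < c\<close> by blast
qed

section \<open>Direct sums\<close>

lemma is_permutation_memD: "is_permutation p \<Longrightarrow> x \<in> set p \<Longrightarrow> 1 \<le> x \<and> x \<le> length p"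
  by (auto simp: is_permutation_def)

lemma is_permutation_Nil [simp]: "is_permutation []"
  by (simp add: is_permutation_def)

lemma direct_sum_Nil [simp]: "[] \<oplus> q = q"
  by (simp add: direct_sum_def)

lemma direct_sum_assoc: "(p \<oplus> q) \<oplus> r = p \<oplus> q \<oplus> r"
  by (simp add: direct_sum_def add.commute add.left_commute)

lemma is_permutation_blocks: "is_permutation [1]" "is_permutation [2,1]" "is_permutation [3,1,2]"
  by (auto simp: is_permutation_def)

lemma is_permutation_direct_sum:
  assumes "is_permutation u" "is_permutation v"
  shows "is_permutation (u \<oplus> v)"
proof -
  have "set (u \<oplus> v) = {1..length u} \<union> {1 + length u..length v + length u}"
    using assms by (simp add: is_permutation_def direct_sum_def image_add_atLeastAtMost')
  then have "set (u \<oplus> v) = {1..length (u \<oplus> v)}"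
    by (auto simp: direct_sum_def)
  moreover have "distinct (u \<oplus> v)"
    using assms by (auto simp: is_permutation_def direct_sum_def distinct_map)
  ultimately show ?thesis by (simp add: is_permutation_def)
qed

text \<open>The prefix \<open>b\<close> uses up the values \<open>1\<close> to
  \<open>length b\<close>, so \<open>t\<close> consists of the values just above and can be shifted
  down.\<close>

lemma is_permutation_prefix_direct_sum:
  assumes p: "is_permutation (b @ t)" and b: "is_permutation b"
  obtains q where "is_permutation q" "b @ t = b \<oplus> q"
proof
  let ?k = "length b"
  let ?q = "map (\<lambda>x. x - ?k) t"
  have t: "set t = {?k + 1..?k + length t}" "distinct t"
  proof -
    have "set t = set (b @ t) - set b"
      using p by (auto simp: is_permutation_def)
    also have "\<dots> = {1..?k + length t} - {1..?k}"
      using p b by (simp only: is_permutation_def length_append)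
    also have "\<dots> = {?k + 1..?k + length t}" by auto
    finally show "set t = {?k + 1..?k + length t}" .
    show "distinct t" using p by (simp add: is_permutation_def)
  qed
  have "(\<lambda>x. x - ?k) ` {?k + 1..?k + length t} = {1..length t}"
    by (force simp: image_iff intro: bexI[of _ "_ + ?k"])
  \<comment> \<open>Truncated subtraction is injective here, and undone by adding \<open>?k\<close>,
    because every entry of \<open>t\<close> exceeds \<open>?k\<close>.\<close>
  moreover have "inj_on (\<lambda>x. x - ?k) (set t)"
    using t by (auto simp: inj_on_def)
  ultimately show "is_permutation ?q"
    using t by (simp add: is_permutation_def distinct_map)
  have "map (\<lambda>x. x + ?k) ?q = t"
    using t by (auto intro!: map_idI)
  then show "b @ t = b \<oplus> ?q" by (simp add: direct_sum_def)
qed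

lemma subseq_shiftE:
  fixes n :: nat
  assumes "subseq s (map (\<lambda>x. x + n) q)"
  obtains r where "s = map (\<lambda>x. x + n) r" "subseq r q"
  using assms by (metis nths_map subseq_conv_nths)

text \<open>Cuts a subsequence at the border of the summands; the second part is returned unshifted,
  so that hypotheses on \<open>v\<close> apply to it.\<close>

lemma subseq_direct_sumE:
  assumes "subseq s (u \<oplus> v)"
  obtains s1 s2 where "s = s1 @ map (\<lambda>x. x + length u) s2" "subseq s1 u" "subseq s2 v"
  using assms unfolding direct_sum_def by (metis subseq_appendE subseq_shiftE)

lemma avoids_direct_sumD2:
  assumes "avoids (u \<oplus> v) q"
  shows "avoids v q"
  unfolding avoids_def
proof clarify
  fix s assume "subseq s v" "order_isomorphic s q"
  then have "subseq (map (\<lambda>x. x + length u) s) (u \<oplus> v)"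
    unfolding direct_sum_def by (simp add: subseq_map list_emb_append2)
  with assms \<open>order_isomorphic s q\<close> show False
    by (auto dest: avoidsD)
qed

text \<open>Patterns whose last entry does not exceed the first one are sum-indecomposable.\<close>

lemma avoids_direct_sumI:
  assumes u: "is_permutation u" "avoids u q" and v: "is_permutation v" "avoids v q"
    and q: "q \<noteq> []" "last q \<le> hd q"
  shows "avoids (u \<oplus> v) q"
  unfolding avoids_def
proof clarify
  fix s assume "subseq s (u \<oplus> v)" and s: "order_isomorphic s q"
  then obtain s1 s2 where s12: "s = s1 @ map (\<lambda>x. x + length u) s2" "subseq s1 u" "subseq s2 v"
    by (metis subseq_direct_sumE)
  \<comment> \<open>An occurrence inside one summand is excluded by hypothesis. So it starts in
    \<open>u\<close> and ends in the shifted \<open>v\<close>, and its last entry exceeds its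
    first.\<close>
  have "s1 \<noteq> []" using s s12 v(2) by (auto dest: avoidsD)
  moreover have "s2 \<noteq> []" using s s12 u(2) by (auto dest: avoidsD)
  ultimately have "hd s \<in> set u" "last s \<in> (\<lambda>x. x + length u) ` set v"
    using s12 by (auto simp: last_map dest!: set_subseq intro: hd_in_set last_in_set)
  then have "hd s < last s"
    using u(1) v(1) by (fastforce dest: is_permutation_memD)
  moreover have "s \<noteq> []" using \<open>s1 \<noteq> []\<close> s12 by simp
  ultimately have "s ! 0 < s ! (length q - 1)"
    using order_isomorphic_lengthD[OF s] by (simp add: hd_conv_nth last_conv_nth)
  then have "hd q < last q"
    using order_isomorphic_nth_less_iff[OF s] q(1) by (simp add: hd_conv_nth last_conv_nth)
  with q(2) show False by simp
qed

text \<open>An occurrence meeting the increasing summand would start with its smallest entry.\<close>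

lemma avoids_increasing_direct_sum:
  assumes u: "is_increasing u" and v: "is_permutation v" "avoids v q"
    and q: "\<exists>x \<in> set q. x < hd q"
  shows "avoids (u \<oplus> v) q"
  unfolding avoids_def
proof clarify
  fix s assume "subseq s (u \<oplus> v)" and s: "order_isomorphic s q"
  then obtain s1 s2 where s12: "s = s1 @ map (\<lambda>x. x + length u) s2" "subseq s1 u" "subseq s2 v"
    by (metis subseq_direct_sumE)
  have "s1 \<noteq> []" using s s12 v(2) by (auto dest: avoidsD)
  then obtain a s1' where s1: "s1 = a # s1'" by (cases s1) auto
  have "sorted_wrt (<) s1"
    using s12(2) u unfolding is_increasing_def by (metis sorted_wrt_subseq)
  moreover have "a \<le> length u"
    using s1 s12(2) u by (auto simp: is_increasing_def dest!: is_permutation_memD set_subseq)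
  \<comment> \<open>The rest of \<open>s1\<close> lies above \<open>a\<close> because
    \<open>s1\<close> increases, the shifted \<open>s2\<close> because \<open>a\<close> is at most
    \<open>length u\<close>.\<close>
  ultimately have a: "\<forall>x \<in> set s. a \<le> x"
    using s1 s12 by auto
  have "q \<noteq> []" using q by auto
  then obtain i where "i < length q" "q ! i < q ! 0" "0 < length q"
    using q by (metis hd_conv_nth in_set_conv_nth length_greater_0_conv)
  then have "s ! i < a" "i < length s"
    using order_isomorphic_nth_less_iff[OF s, of i 0] order_isomorphic_lengthD[OF s] s1 s12 by auto
  with a show False by (meson leD nth_mem)
qed

section \<open>Splitting off the first block\<close>

text \<open>Otherwise \<open>m\<close> comes after \<open>x\<close>, and \<open>h\<close>,
  \<open>x\<close>, \<open>m\<close> form a \<open>231\<close> if \<open>h < x\<close> and a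
  \<open>321\<close> if \<open>x < h\<close>.\<close>

lemma next_entry_minimal:
  assumes av: "avoids (h # us @ x # t) [2,3,1]" "avoids (h # us @ x # t) [3,2,1]"
    and p: "distinct (h # us @ x # t)"
    and m: "m \<in> set (x # t)" "m < h" "\<forall>y \<in> set (x # t). m \<le> y"
  shows "x = m"
proof (rule ccontr)
  assume "x \<noteq> m"
  with m have "m \<in> set t" "m < x" by force+
  then have "subseq [x,m] (x # t)" by (simp add: subseq_singleton_left)
  then have "subseq [h,x,m] (h # us @ x # t)" by (simp add: list_emb_append2)
  with av have "\<not> order_isomorphic [h,x,m] [2,3,1]" "\<not> order_isomorphic [h,x,m] [3,2,1]"
    by (auto dest: avoidsD)
  with \<open>m < x\<close> \<open>m < h\<close> p show False
    by (auto simp: order_isomorphic_patterns)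
qed

text \<open>The values below the first entry \<open>h\<close> are read off one by one behind it,
  until a prefix that is itself a permutation is complete.\<close>

lemma split_first_block:
  assumes p: "is_permutation p" "p \<noteq> []"
    and av: "avoids p [2,3,1]" "avoids p [3,2,1]" "avoids p [4,1,2,3]"
  obtains b q where "p = b \<oplus> q" "b \<in> {[1], [2,1], [3,1,2]}" "is_permutation q"
proof -
  obtain h t where ht: "p = h # t" using p(2) by (cases p) auto
  have dist: "distinct p" and set: "set p = {1..length p}"
    using p(1) by (auto simp: is_permutation_def)
  have h: "1 \<le> h" "h \<le> length p" using set ht by auto
  \<comment> \<open>The list \<open>us\<close> holds the values below \<open>m\<close> already
    found, so \<open>m\<close> is the least value left in \<open>r\<close>.\<close>
  have next_entry: "\<exists>t'. r = m # t'"
    if r: "p = h # us @ r" "m < h" "1 \<le> m" "set us = {1..<m}" for us r m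
  proof -
    have "m \<in> set p" using set h r by auto
    then have "m \<in> set r" using r by auto
    then obtain x t' where xt: "r = x # t'" by (cases r) auto
    have "\<forall>y \<in> set r. m \<le> y"
    proof
      fix y assume "y \<in> set r"
      then have "y \<notin> set us" "y \<in> set p" using dist r by auto
      then show "m \<le> y" using set r(4) by auto
    qed
    then have "x = m"
      using next_entry_minimal[of h us x t' m] av dist r xt \<open>m \<in> set r\<close> by simp
    with xt show ?thesis by simp
  qed
  have "\<exists>b t'. p = b @ t' \<and> b \<in> {[1], [2,1], [3,1,2]}"
  proof (cases "h = 1")
    case True
    then show ?thesis using ht by (intro exI[of _ "[1]"] exI[of _ t]) simp
  next
    case False
    with h have "1 < h" by simp
    then obtain t1 where t1: "t = 1 # t1" using next_entry[of "[]" t 1] ht by auto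
    show ?thesis
    proof (cases "h = 2")
      case True
      then show ?thesis using ht t1 by (intro exI[of _ "[2,1]"] exI[of _ t1]) simp
    next
      case False
      with \<open>1 < h\<close> have "2 < h" by simp
      moreover have "{1..<2} = {1::nat}" by auto
      ultimately obtain t2 where t2: "t1 = 2 # t2" using next_entry[of "[1]" t1 2] ht t1 by auto
      show ?thesis
      proof (cases "h = 3")
        case True
        then show ?thesis using ht t1 t2 by (intro exI[of _ "[3,1,2]"] exI[of _ t2]) simp
      next
        case False
        with \<open>2 < h\<close> have "3 < h" by simp
        moreover have "{1..<3} = {1, 2::nat}" by auto
        ultimately obtain t3 where "t2 = 3 # t3"
          using next_entry[of "[1,2]" t2 3] ht t1 t2 by auto
        \<comment> \<open>Reading stops here: if \<open>h > 3\<close>, these four entries form a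
          \<open>4123\<close>.\<close>
        then have "subseq [h,1,2,3] p" using ht t1 t2 by simp
        then have "\<not> order_isomorphic [h,1,2,3] [4,1,2,3]" using av(3) by (rule avoidsD[rotated])
        with \<open>3 < h\<close> show ?thesis by (simp add: order_isomorphic_patterns)
      qed
    qed
  qed
  then obtain b t' where b: "p = b @ t'" "b \<in> {[1], [2,1], [3,1,2]}" by blast
  moreover from b(2) have "is_permutation b" using is_permutation_blocks by auto
  ultimately show thesis
    using that p(1) is_permutation_prefix_direct_sum by metis
qed

section \<open>Decomposition of permutations in \<open>Av(A2)\<close>\<close>

text \<open>A descent \<open>21\<close> at the front turns every later \<open>312\<close> into a \<open>21534\<close>.\<close>

lemma avoids_312_after_descent:
  assumes av: "avoids (b \<oplus> q) [2,1,5,3,4]" and b: "b \<in> {[2,1], [3,1,2]}"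
    and q: "is_permutation q"
  shows "avoids q [3,1,2]"
  unfolding avoids_def order_isomorphic_312
proof clarify
  fix x y z assume s: "subseq [x,y,z] q" and "y < z" "z < x"
  let ?k = "length b"
  have "y \<in> set q" using set_subseq[OF s] by simp
  then have "1 \<le> y" using is_permutation_memD[OF q] by blast
  \<comment> \<open>In both blocks \<open>hd b\<close> equals \<open>?k\<close> and is followed by
    \<open>1\<close>, which gives the descent; \<open>1 \<le> y\<close> puts the shifted
    \<open>312\<close> strictly above it.\<close>
  have "subseq ([hd b, 1] @ map (\<lambda>x. x + ?k) [x,y,z]) (b \<oplus> q)"
    unfolding direct_sum_def using b s by (intro list_emb_append_mono subseq_map) auto
  then have "\<not> order_isomorphic [hd b, 1, x + ?k, y + ?k, z + ?k] [2,1,5,3,4]"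
    using avoidsD[OF av] by simp
  then show False
    using b \<open>y < z\<close> \<open>z < x\<close> \<open>1 \<le> y\<close> by (auto simp: order_isomorphic_patterns)
qed

text \<open>If \<open>p\<close> avoids \<open>312\<close>, all of it is \<open>\<tau>\<close>.
  Otherwise its first block decides: a \<open>1\<close> is prepended to the \<open>\<pi>\<close>
  obtained by induction, while a \<open>312\<close> becomes \<open>\<sigma>\<close> and the rest is
  Fibonacci.\<close>

lemma Av_A2_decomposition:
  assumes "p \<in> Av A2"
  shows "\<exists>\<pi> \<sigma> \<tau>. p = \<pi> \<oplus> \<sigma> \<oplus> \<tau> \<and> is_increasing \<pi> \<and>
      (\<sigma> = [] \<or> \<sigma> = [3,1,2]) \<and> is_fibonacci \<tau>"
  using assms
proof (induction "length p" arbitrary: p rule: less_induct)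
  case less
  have Nil: "is_increasing []" by (simp add: is_increasing_def)
  have p: "is_permutation p" and av: "\<forall>r \<in> A2. avoids p r"
    using less.prems by (auto simp: Av_def)
  show ?case
  proof (cases "avoids p [3,1,2]")
    case True
    then have "is_fibonacci p" using p av by (simp add: is_fibonacci_def Av_def A2_def)
    then show ?thesis using Nil by (intro exI[of _ "[]"] exI[of _ p]) simp
  next
    case False
    then have "p \<noteq> []" by (auto simp: avoids_shorter)
    with p av obtain b q where bq: "p = b \<oplus> q" "b \<in> {[1], [2,1], [3,1,2]}" "is_permutation q"
      by (auto simp: A2_def elim: split_first_block)
    have q: "\<forall>r \<in> A2. avoids q r" using av bq(1) avoids_direct_sumD2 by blast
    show ?thesis
    proof (cases "b = [1]")
      case True
      have "length q < length p" using bq True by (simp add: direct_sum_def)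
      moreover have "q \<in> Av A2" using q bq(3) by (simp add: Av_def)
      ultimately obtain \<pi> \<sigma> \<tau> where d: "q = \<pi> \<oplus> \<sigma> \<oplus> \<tau>" "is_increasing \<pi>"
          "\<sigma> = [] \<or> \<sigma> = [3,1,2]" "is_fibonacci \<tau>"
        using less.hyps by blast
      have "is_increasing ([1] \<oplus> \<pi>)"
        using d(2) by (auto simp: is_increasing_def is_permutation_def direct_sum_def
            sorted_wrt_map distinct_map image_Suc_atLeastAtMost)
      then show ?thesis using d bq True by (metis direct_sum_assoc)
    next
      case False
      with bq have b: "b \<in> {[2,1], [3,1,2]}" by simp
      have "avoids q [3,1,2]"
        using avoids_312_after_descent[OF _ b bq(3)] av bq(1) by (simp add: A2_def)
      with q bq(3) have fib: "is_fibonacci q" by (simp add: is_fibonacci_def Av_def A2_def)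
      \<comment> \<open>The rest \<open>q\<close> avoids \<open>312\<close>, and a leading
        \<open>21\<close> cannot create one, contrary to the case assumption on
        \<open>p\<close>.\<close>
      have "b \<noteq> [2,1]"
      proof
        assume "b = [2,1]"
        then have "avoids p [3,1,2]"
          using bq \<open>avoids q [3,1,2]\<close> is_permutation_blocks
          by (auto intro!: avoids_direct_sumI simp: avoids_shorter)
        with \<open>\<not> avoids p [3,1,2]\<close> show False by simp
      qed
      with b have "p = [] \<oplus> [3,1,2] \<oplus> q" using bq by simp
      with fib Nil show ?thesis by blast
    qed
  qed
qed

section \<open>Avoidance of \<open>A2\<close> by sums of the given form\<close>

text \<open>An occurrence using the whole block would have \<open>2\<close> as its largest entry.
  Otherwise at most two of its entries lie in the block, and its last three form a
  \<open>312\<close> in \<open>v\<close>.\<close>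

lemma avoids_312_direct_sum:
  assumes "is_permutation v" "avoids v [3,1,2]"
  shows "avoids ([3,1,2] \<oplus> v) [2,1,5,3,4]"
  unfolding avoids_def order_isomorphic_21534
proof clarify
  fix a b c d e assume s: "subseq [a,b,c,d,e] ([3,1,2] \<oplus> v)"
    and less: "b < a" "a < d" "d < e" "e < c"
  obtain s1 s2 where s12: "[a,b,c,d,e] = s1 @ map (\<lambda>x. x + length [3::nat,1,2]) s2"
      "subseq s1 [3,1,2]" "subseq s2 v"
    using s by (rule subseq_direct_sumE)
  have len: "length s1 \<le> 3" using s12(2) by (auto dest: list_emb_length)
  show False
  proof (cases "length s1 = 3")
    case True
    then have "s1 = [3,1,2]" using s12(2) subseq_same_length by fastforce
    with s12(1) less show False by simp
  next
    case False
    with len have len: "length s1 \<le> 2" by simp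
    \<comment> \<open>The first \<open>2 - length s1\<close> entries of \<open>s2\<close> are those
      of \<open>a\<close>, \<open>b\<close> outside the block; dropping them leaves
      \<open>c\<close>, \<open>d\<close>, \<open>e\<close>.\<close>
    have "drop 2 [a,b,c,d,e] = map (\<lambda>x. x + length [3::nat,1,2]) (drop (2 - length s1) s2)"
      unfolding s12(1) using len by (simp add: drop_map)
    then have "order_isomorphic (drop (2 - length s1) s2) [3,1,2]"
      using less by (metis order_isomorphic_312 order_isomorphic_shift_iff drop_Suc_Cons drop0
          numeral_2_eq_2)
    moreover have "subseq (drop (2 - length s1) s2) v"
      using s12(3) by (meson subseq_order.trans suffix_drop suffix_imp_subseq)
    ultimately show False using assms(2) by (auto dest: avoidsD)
  qed
qed

text \<open>It suffices to treat \<open>\<sigma> = [3,1,2]\<close>, since avoidance passes to the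
  summand \<open>\<tau>\<close>. All patterns but \<open>21534\<close> end below their first entry,
  so they can be checked summand by summand.\<close>

lemma avoids_A2_block_fibonacci:
  assumes \<sigma>: "\<sigma> = [] \<or> \<sigma> = [3,1,2]" and \<tau>: "is_fibonacci \<tau>" and "r \<in> A2"
  shows "avoids (\<sigma> \<oplus> \<tau>) r"
proof -
  have perm: "is_permutation \<tau>"
    and av: "avoids \<tau> [2,3,1]" "avoids \<tau> [3,1,2]" "avoids \<tau> [3,2,1]"
    using \<tau> by (auto simp: is_fibonacci_def Av_def)
  have "avoids ([3,1,2] \<oplus> \<tau>) r"
  proof (cases "r = [2,1,5,3,4]")
    case True
    then show ?thesis using avoids_312_direct_sum perm av by simp
  next
    case False
    then have r: "r \<in> {[2,3,1], [3,2,1], [4,1,2,3]}" using \<open>r \<in> A2\<close> by (simp add: A2_def)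
    have "avoids [3,1,2] r"
      using r by (auto simp: avoids_shorter avoids_same_length order_isomorphic_patterns)
    moreover have "avoids \<tau> r" using r av avoids_4123_if_312 by auto
    ultimately show ?thesis
      using r perm is_permutation_blocks by (intro avoids_direct_sumI) auto
  qed
  moreover from this have "avoids \<tau> r" by (rule avoids_direct_sumD2)
  ultimately show ?thesis using \<sigma> by auto
qed

theorem theorem2p3:
  fixes p :: "nat list"
  assumes "is_permutation p"
  shows "p \<in> Av A2 \<longleftrightarrow>
    (\<exists>\<pi> \<sigma> \<tau>. p = \<pi> \<oplus> \<sigma> \<oplus> \<tau> \<and> is_increasing \<pi> \<and>
      (\<sigma> = [] \<or> \<sigma> = [3,1,2]) \<and> is_fibonacci \<tau>)"
proof
  assume "p \<in> Av A2"
  then show "\<exists>\<pi> \<sigma> \<tau>. p = \<pi> \<oplus> \<sigma> \<oplus> \<tau> \<and> is_increasing \<pi> \<and>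
      (\<sigma> = [] \<or> \<sigma> = [3,1,2]) \<and> is_fibonacci \<tau>"
    by (rule Av_A2_decomposition)
next
  assume "\<exists>\<pi> \<sigma> \<tau>. p = \<pi> \<oplus> \<sigma> \<oplus> \<tau> \<and> is_increasing \<pi> \<and>
      (\<sigma> = [] \<or> \<sigma> = [3,1,2]) \<and> is_fibonacci \<tau>"
  then obtain \<pi> \<sigma> \<tau> where d: "p = \<pi> \<oplus> \<sigma> \<oplus> \<tau>" "is_increasing \<pi>"
      "\<sigma> = [] \<or> \<sigma> = [3,1,2]" "is_fibonacci \<tau>"
    by blast
  have "is_permutation \<tau>" using d(4) by (simp add: is_fibonacci_def Av_def)
  then have "is_permutation (\<sigma> \<oplus> \<tau>)"
    using d(3) is_permutation_direct_sum is_permutation_blocks by auto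
  moreover have "avoids (\<sigma> \<oplus> \<tau>) r" if "r \<in> A2" for r
    using that d by (intro avoids_A2_block_fibonacci) auto
  \<comment> \<open>This is what allows an increasing summand to be put in front.\<close>
  moreover have "\<exists>x \<in> set r. x < hd r" if "r \<in> A2" for r
    using that by (auto simp: A2_def)
  ultimately have "avoids p r" if "r \<in> A2" for r
    unfolding d(1) using that d(2) by (blast intro: avoids_increasing_direct_sum)
  with assms show "p \<in> Av A2" by (simp add: Av_def)
qed

end
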